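(* For each integer $n\ge1$ put $$G_n=e^{-in}\,{}_3F_1\left(\begin{array}{c}-n,\ n,\ 1\\ 1/2\end{array}\,\Big|\,\frac{i}{2n}\right).$$ Then, as $n\to\infty$ through even integers, $$\mathrm{Im}\,G_n\sim-\frac{6^{1/3}\,\Gamma(1/3)\,(-1)^{n/2}}{4\sqrt{3}}\,n^{2/3},$$ and, as $n\to\infty$ through odd integers, $$\mathrm{Re}\,G_n\sim\frac{6^{1/3}\,\Gamma(1/3)\,(-1)^{(n+1)/2}}{4\sqrt{3}}\,n^{2/3}.$$ The behavior at $z=-i$ is obtained by complex conjugation: $$e^{in}\,{}_3F_1\left(\begin{array}{c}-n,\ n,\ 1\\ 1/2\end{array}\,\Big|\,\frac{-i}{2n}\right)=\overline{G_n}.$$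
   Context: For a positive integer $n$ and a complex number $w$, the terminating hypergeometric series (a polynomial in $w$) is $${}_3F_1\left(\begin{array}{c}-n,\ n,\ 1\\ 1/2\end{array}\,\Big|\,w\right)=\sum_{k=0}^{n}\frac{(-n)_k\,(n)_k\,(1)_k}{(1/2)_k\,k!}\,w^k,$$ where $(a)_0=1$ and $(a)_k=a(a+1)\cdots(a+k-1)$ is the Pochhammer symbol. $\Gamma$ is the Gamma function. The points $z=\pm i$ refer to evaluating the polynomial ${}_3F_1\left(\begin{array}{c}-n,\ n,\ 1\\ 1/2\end{array}\,\Big|\,\frac{z}{2n}\right)$ in $z$. The symbol $a_n\sim b_n$ means $a_n/b_n\to1$ as $n\to\infty$ (through integers of the given parity). *)

theory Defs
  imports "HOL-Analysis.Analysis" "HOL-Library.Landau_Symbols"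
begin

definition hyp3F1 :: "nat \<Rightarrow> complex \<Rightarrow> complex" where
  "hyp3F1 n w =
     (\<Sum>k=0..n. pochhammer (- of_nat n) k * pochhammer (of_nat n) k * pochhammer 1 k
               / (pochhammer (1/2) k * fact k) * w ^ k)"

definition G :: "nat \<Rightarrow> complex" where
  "G n = exp (- \<i> * of_nat n) * hyp3F1 n (\<i> / (2 * of_nat n))"

end

theory Submission
  imports
    Defs
    "HOL-Complex_Analysis.Cauchy_Integral_Theorem"
    "HOL-Real_Asymp.Real_Asymp"
begin

text \<open>Write \<open>T\<close> for the Chebyshev polynomial of degree \<open>n\<close>, so that
\<open>T (cos t) = cos (n t)\<close>. Its derivatives at \<open>1\<close> are the products of the factors
\<open>(n^2 - j^2) / (2 j + 1)\<close>, the same that make up the hypergeometric coefficients; hence the value of the \<open>3F1\<close> at \<open>\<i> / (2 n)\<close> is the sum \<open>H 1\<close>, where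
\<open>H x = \<Sum>k. T^(k) x / (\<i> n)^k\<close>. This \<open>H\<close> solves \<open>H' = \<i> n (H - T)\<close>, so
\<open>exp (-\<i> n x) H x\<close> is, up to the factor \<open>-\<i> n\<close>, an antiderivative of
\<open>exp (-\<i> n x) T x\<close>. At \<open>x = 1\<close> it equals \<open>G n\<close> and, by the parity of \<open>T\<close>,
at \<open>x = -1\<close> it equals \<open>(-1)^n cnj (G n)\<close>. The combination \<open>G n - (-1)^n cnj (G n)\<close>, which is
\<open>2 \<i> Im (G n)\<close> for even and \<open>2 Re (G n)\<close> for odd \<open>n\<close>, is therefore an oscillatory integral over
\<open>[-1, 1]\<close>, and with \<open>x = cos t\<close> over \<open>[0, \<pi>]\<close> (lemma \<open>G_reflection_integral\<close>).

Splitting \<open>cos (n t)\<close> into exponentials gives the two phases \<open>cos t - t\<close> and \<open>cos t + t\<close>. The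
first one has no stationary point in \<open>[0, \<pi>]\<close> and contributes \<open>O(1/n)\<close>
(\<open>nonstationary_integral\<close>). The second one has the degenerate stationary point \<open>t = \<pi>/2\<close>: with
\<open>t = \<pi>/2 + u\<close> it is \<open>\<pi>/2 + u - sin u\<close>, and \<open>u - sin u\<close> behaves like \<open>u^3/6\<close>. This cubic
behaviour produces the order \<open>n powr (-1/3)\<close> and the value \<open>Gamma (1/3)\<close>.

To evaluate the stationary contribution, the path from \<open>0\<close> to \<open>\<pi>/2\<close> of
\<open>exp (\<i> n (z - sin z)) cos z\<close> is replaced by a segment in the direction \<open>sqrt 3 + \<i>\<close>, on which
\<open>\<i> z^3\<close> is real and negative, up to the vertical line through \<open>\<pi>/2\<close>, followed by the descent along
that line, on which the modulus of the exponential is \<open>exp (- n Im z)\<close>. The descent costs \<open>O(1/n)\<close>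
(\<open>contour_shift_error\<close>). On the segment, scaling by \<open>n powr (1/3)\<close> and dominated convergence lead to
the integral of \<open>exp (- 4 s^3 / 3)\<close> (\<open>ray_integral_limit\<close>), which is a Gamma integral.\<close>

section \<open>Chebyshev polynomials and their derivatives at the endpoints\<close>

fun chebyshev :: "nat \<Rightarrow> real poly" where
  "chebyshev 0 = 1"
| "chebyshev (Suc 0) = [:0, 1:]"
| "chebyshev (Suc (Suc n)) = [:0, 2:] * chebyshev (Suc n) - chebyshev n"

lemma poly_chebyshev_cos: "poly (chebyshev n) (cos t) = cos (real n * t)"
proof (induction n rule: chebyshev.induct)
  case (3 n)
  have "cos (real (Suc (Suc n)) * t) + cos (real n * t) = 2 * cos t * cos (real (Suc n) * t)"
    using cos_plus_cos[of "real (Suc (Suc n)) * t" "real n * t"]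
    by (simp add: algebra_simps add_divide_distrib)
  with 3 show ?case by (simp add: algebra_simps)
qed auto

lemma degree_chebyshev_le: "degree (chebyshev n) \<le> n"
proof (induction n rule: chebyshev.induct)
  case (3 n)
  have "degree ([:0, 2:] * chebyshev (Suc n)) \<le> Suc (Suc n)"
    using degree_mult_le[of "[:0, 2:]" "chebyshev (Suc n)"] 3 by simp
  with 3 show ?case by (auto intro!: degree_diff_le)
qed auto

text \<open>Differentiating \<open>T (cos t) = cos (n t)\<close> twice gives the equation at every point of \<open>[-1, 1]\<close>; a
polynomial with that many roots vanishes.\<close>
lemma chebyshev_ode:
  "[:1, 0, -1:] * pderiv (pderiv (chebyshev n)) - [:0, 1:] * pderiv (chebyshev n)
     + smult ((real n)\<^sup>2) (chebyshev n) = 0" (is "?p = 0")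
proof (rule ccontr)
  let ?T = "chebyshev n"
  assume "?p \<noteq> 0"
  then have fin: "finite {x. poly ?p x = 0}"
    by (rule poly_roots_finite)
  have first: "poly (pderiv ?T) (cos t) * sin t = real n * sin (real n * t)" for t
  proof -
    have "((\<lambda>t. poly ?T (cos t)) has_field_derivative poly (pderiv ?T) (cos t) * - sin t) (at t)"
      by (rule DERIV_chain2[OF poly_DERIV]) (auto intro!: derivative_eq_intros)
    moreover have "((\<lambda>t. poly ?T (cos t)) has_field_derivative - sin (real n * t) * real n) (at t)"
      unfolding poly_chebyshev_cos by (auto intro!: derivative_eq_intros)
    ultimately show ?thesis
      using DERIV_unique by fastforce
  qed
  have root: "poly ?p (cos t) = 0" for t
  proof -
    have "((\<lambda>t. poly (pderiv ?T) (cos t) * sin t) has_field_derivative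
        (poly (pderiv (pderiv ?T)) (cos t) * - sin t) * sin t + cos t * poly (pderiv ?T) (cos t)) (at t)"
      by (intro DERIV_mult DERIV_chain2[OF poly_DERIV]) (auto intro!: derivative_eq_intros)
    moreover have "((\<lambda>t. poly (pderiv ?T) (cos t) * sin t) has_field_derivative
        real n * (cos (real n * t) * real n)) (at t)"
      unfolding first by (auto intro!: derivative_eq_intros)
    ultimately have "(poly (pderiv (pderiv ?T)) (cos t) * - sin t) * sin t + cos t * poly (pderiv ?T) (cos t)
        = real n * (cos (real n * t) * real n)"
      by (rule DERIV_unique)
    moreover have "poly ?p (cos t) = (1 - cos t * cos t) * poly (pderiv (pderiv ?T)) (cos t)
        - cos t * poly (pderiv ?T) (cos t) + real n * (cos (real n * t) * real n)"
      by (simp add: poly_chebyshev_cos power2_eq_square algebra_simps)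
    moreover have "1 - cos t * cos t = sin t * sin t"
      using sin_cos_squared_add[of t] by (simp add: power2_eq_square algebra_simps)
    ultimately show ?thesis by (simp only:) (simp add: algebra_simps)
  qed
  have "{-1..1} \<subseteq> {x. poly ?p x = 0}"
  proof
    fix x :: real assume "x \<in> {-1..1}"
    then have "cos (arccos x) = x" by auto
    with root[of "arccos x"] show "x \<in> {x. poly ?p x = 0}" by simp
  qed
  then have "finite {-1..1::real}" using fin finite_subset by blast
  then show False using infinite_Icc[of "-1" "1::real"] by simp
qed

text \<open>At \<open>x = 1\<close> and \<open>x = -1\<close> the leading coefficient vanishes, so there the differentiated equation
is a two-term recurrence for the higher derivatives.\<close>
lemma chebyshev_ode_iterated:
  "[:1, 0, -1:] * (pderiv ^^ Suc (Suc k)) (chebyshev n)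
     - [:0, 2 * real k + 1:] * (pderiv ^^ Suc k) (chebyshev n)
     + smult ((real n)\<^sup>2 - (real k)\<^sup>2) ((pderiv ^^ k) (chebyshev n)) = 0"
proof (induction k)
  case 0
  show ?case using chebyshev_ode[of n] by simp
next
  case (Suc k)
  let ?D = "\<lambda>k. (pderiv ^^ k) (chebyshev n)"
  have "0 = pderiv ([:1, 0, -1:] * ?D (Suc (Suc k)) - [:0, 2 * real k + 1:] * ?D (Suc k)
     + smult ((real n)\<^sup>2 - (real k)\<^sup>2) (?D k))"
    unfolding Suc by simp
  also have "\<dots> = [:1, 0, -1:] * ?D (Suc (Suc (Suc k))) + [:0, -2:] * ?D (Suc (Suc k))
     - [:0, 2 * real k + 1:] * ?D (Suc (Suc k)) - [:2 * real k + 1:] * ?D (Suc k)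
     + smult ((real n)\<^sup>2 - (real k)\<^sup>2) (?D (Suc k))"
    by (simp add: pderiv_diff pderiv_add pderiv_mult pderiv_smult pderiv_pCons algebra_simps
        del: mult_pCons_left mult_pCons_right)
  also have "\<dots> = [:1, 0, -1:] * ?D (Suc (Suc (Suc k))) - [:0, 2 * real (Suc k) + 1:] * ?D (Suc (Suc k))
     + smult ((real n)\<^sup>2 - (real (Suc k))\<^sup>2) (?D (Suc k))"
    by (rule poly_eq_poly_eq_iff[THEN iffD1, OF ext]) (simp add: algebra_simps power2_eq_square del: funpow.simps)
  finally show ?case by simp
qed

text \<open>The \<open>k\<close>-th derivative of the \<open>n\<close>-th Chebyshev polynomial at \<open>1\<close>.\<close>
definition chebyshev_deriv1 :: "nat \<Rightarrow> nat \<Rightarrow> real" where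
  "chebyshev_deriv1 n k = (\<Prod>j<k. ((real n)\<^sup>2 - (real j)\<^sup>2) / (2 * real j + 1))"

lemma higher_pderiv_chebyshev_endpoint:
  assumes "x = 1 \<or> x = (-1::real)"
  shows "poly ((pderiv ^^ k) (chebyshev n)) x = x ^ (n + k) * chebyshev_deriv1 n k"
proof (induction k)
  case 0
  have "poly (chebyshev n) 1 = 1"
    using poly_chebyshev_cos[of n 0] by simp
  moreover have "poly (chebyshev n) (-1) = (-1) ^ n"
    using poly_chebyshev_cos[of n pi] by (simp add: cos_npi)
  ultimately show ?case using assms by (auto simp: chebyshev_deriv1_def)
next
  case (Suc k)
  have x2: "x * x = 1" using assms by auto
  let ?D = "\<lambda>k. (pderiv ^^ k) (chebyshev n)"
  have "0 = poly ([:1, 0, -1:] * ?D (Suc (Suc k)) - [:0, 2 * real k + 1:] * ?D (Suc k)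
     + smult ((real n)\<^sup>2 - (real k)\<^sup>2) (?D k)) x"
    unfolding chebyshev_ode_iterated by simp
  also have "\<dots> = (1 - x * x) * poly (?D (Suc (Suc k))) x - (2 * real k + 1) * (x * poly (?D (Suc k)) x)
     + ((real n)\<^sup>2 - (real k)\<^sup>2) * poly (?D k) x"
    by (simp add: algebra_simps del: funpow.simps)
  finally have "(2 * real k + 1) * (x * poly (?D (Suc k)) x)
      = ((real n)\<^sup>2 - (real k)\<^sup>2) * (x ^ (n + k) * chebyshev_deriv1 n k)"
    unfolding x2 Suc by simp
  then have "x * poly ((pderiv ^^ Suc k) (chebyshev n)) x
      = ((real n)\<^sup>2 - (real k)\<^sup>2) * (x ^ (n + k) * chebyshev_deriv1 n k) / (2 * real k + 1)"
    by (subst eq_divide_eq) (simp add: mult_ac add_nonneg_eq_0_iff del: funpow.simps)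
  also have "\<dots> = x ^ (n + k) * chebyshev_deriv1 n (Suc k)"
    by (simp add: chebyshev_deriv1_def)
  finally have "x * (x * poly ((pderiv ^^ Suc k) (chebyshev n)) x)
      = x ^ (n + Suc k) * chebyshev_deriv1 n (Suc k)"
    by (simp del: funpow.simps)
  then show ?case
    using x2 by (simp flip: mult.assoc del: funpow.simps)
qed

text \<open>The quotients of consecutive terms agree: both are
\<open>(n\<^sup>2 - k\<^sup>2) / ((2 k + 1) \<i> n)\<close>, because \<open>(k - n) (k + n) = k\<^sup>2 - n\<^sup>2\<close>.\<close>
lemma hyp3F1_eq_chebyshev_sum:
  assumes "n \<ge> 1"
  shows "hyp3F1 n (\<i> / (2 * of_nat n))
       = (\<Sum>k\<le>n. of_real (chebyshev_deriv1 n k) / (\<i> * of_nat n) ^ k)"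
proof -
  have "pochhammer (- of_nat n) k * pochhammer (of_nat n) k / pochhammer (1/2) k * (\<i> / (2 * of_nat n)) ^ k
      = of_real (chebyshev_deriv1 n k) / (\<i> * of_nat n) ^ k" for k
  proof (induction k)
    case 0
    show ?case by (simp add: chebyshev_deriv1_def)
  next
    case (Suc k)
    have nz: "2 * complex_of_nat k + 1 \<noteq> 0"
    proof
      assume "2 * complex_of_nat k + 1 = 0"
      then have "complex_of_nat (2 * k + 1) = 0" by (simp add: add.commute)
      then show False by (subst (asm) of_nat_eq_0_iff) simp
    qed
    have step: "(- of_nat n + of_nat k) * (of_nat n + of_nat k) / (1/2 + of_nat k) * (\<i> / (2 * of_nat n))
      = complex_of_real (((real n)\<^sup>2 - (real k)\<^sup>2) / (2 * real k + 1)) / (\<i> * of_nat n)"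
    proof -
      have half: "1/2 + of_nat k = (2 * of_nat k + 1) / (2::complex)"
        by (simp add: field_simps)
      have num: "(- of_nat n + of_nat k) * (of_nat n + of_nat k)
          = - complex_of_real ((real n)\<^sup>2 - (real k)\<^sup>2)"
        by (simp add: algebra_simps power2_eq_square)
      have quot: "- x / (a / 2) * (\<i> / (2 * of_nat n)) = x / a / (\<i> * of_nat n)" for x a :: complex
        by (simp add: divide_simps)
      show ?thesis unfolding half num quot by simp
    qed
    have "pochhammer (- of_nat n) (Suc k) * pochhammer (of_nat n) (Suc k) / pochhammer (1/2) (Suc k)
        * (\<i> / (2 * of_nat n)) ^ Suc k
      = (pochhammer (- of_nat n) k * pochhammer (of_nat n) k / pochhammer (1/2) k * (\<i> / (2 * of_nat n)) ^ k)
        * ((- of_nat n + of_nat k) * (of_nat n + of_nat k) / (1/2 + of_nat k) * (\<i> / (2 * of_nat n)))"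
      by (simp add: pochhammer_Suc mult_ac)
    also have "\<dots> = of_real (chebyshev_deriv1 n (Suc k)) / (\<i> * of_nat n) ^ Suc k"
      unfolding Suc step by (simp add: chebyshev_deriv1_def)
    finally show ?case .
  qed
  then show ?thesis
    by (simp add: hyp3F1_def pochhammer_fact[symmetric] atLeast0AtMost)
qed

section \<open>The reflection formula as an oscillatory integral\<close>

text \<open>The function that repeated integration by parts of \<open>exp (-\<i> n x) T x\<close> produces at the
boundary; it connects the values at \<open>1\<close> and \<open>-1\<close>.\<close>
definition boundary_sum :: "nat \<Rightarrow> real \<Rightarrow> complex" where
  "boundary_sum n x = (\<Sum>k\<le>n. of_real (poly ((pderiv ^^ k) (chebyshev n)) x) / (\<i> * of_nat n) ^ k)"

text \<open>The sign \<open>(-1)^(n + k)\<close> of the \<open>k\<close>-th derivative at \<open>-1\<close> splits into \<open>(-1)^n\<close> and a factor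
that turns \<open>1 / (\<i> n)^k\<close> into its conjugate.\<close>
lemma boundary_sum_endpoints:
  assumes "n \<ge> 1"
  shows "boundary_sum n 1 = hyp3F1 n (\<i> / (2 * of_nat n))"
    and "boundary_sum n (-1) = (-1) ^ n * cnj (hyp3F1 n (\<i> / (2 * of_nat n)))"
proof -
  show "boundary_sum n 1 = hyp3F1 n (\<i> / (2 * of_nat n))"
    using assms by (simp add: boundary_sum_def hyp3F1_eq_chebyshev_sum higher_pderiv_chebyshev_endpoint)
  have "of_real ((- 1) ^ (n + k) * chebyshev_deriv1 n k) / (\<i> * of_nat n) ^ k
      = (- 1) ^ n * cnj (of_real (chebyshev_deriv1 n k) / (\<i> * of_nat n) ^ k)" for k
    by (cases "even k") (simp_all add: power_add power_mult_distrib power_minus[of \<i>])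
  then show "boundary_sum n (-1) = (-1) ^ n * cnj (hyp3F1 n (\<i> / (2 * of_nat n)))"
    using assms
    by (simp add: boundary_sum_def hyp3F1_eq_chebyshev_sum higher_pderiv_chebyshev_endpoint sum_distrib_left)
qed

text \<open>Differentiation shifts the sum by one index: the term that would enter at the top is zero since
\<open>T\<close> has degree at most \<open>n\<close>, and the term that is lost at the bottom is \<open>T\<close> itself.\<close>
lemma boundary_sum_has_vector_derivative:
  assumes "n \<ge> 1"
  shows "(boundary_sum n has_vector_derivative
           \<i> * of_nat n * (boundary_sum n x - of_real (poly (chebyshev n) x))) (at x)"
proof -
  let ?D = "\<lambda>k. (pderiv ^^ k) (chebyshev n)" and ?w = "\<i> * of_nat n :: complex"
  have w: "?w \<noteq> 0" using assms by simp
  have "?D (Suc n) = 0"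
    using degree_chebyshev_le[of n] by (intro poly_eqI) (simp add: coeff_higher_pderiv coeff_eq_0 del: funpow.simps)
  have "(boundary_sum n has_vector_derivative (\<Sum>k\<le>n. of_real (poly (?D (Suc k)) x) / ?w ^ k)) (at x)"
    unfolding boundary_sum_def
    by (intro has_vector_derivative_sum has_vector_derivative_divide has_vector_derivative_of_real)
       (simp add: poly_DERIV has_real_derivative_iff_has_vector_derivative[symmetric])
  also have "(\<Sum>k\<le>n. of_real (poly (?D (Suc k)) x) / ?w ^ k)
      = ?w * (\<Sum>k\<le>n. of_real (poly (?D (Suc k)) x) / ?w ^ Suc k)"
    using w by (simp add: sum_distrib_left field_simps del: funpow.simps)
  also have "(\<Sum>k\<le>n. of_real (poly (?D (Suc k)) x) / ?w ^ Suc k)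
      = (\<Sum>k\<le>Suc n. of_real (poly (?D k) x) / ?w ^ k) - of_real (poly (chebyshev n) x)"
    by (subst sum.atMost_Suc_shift) simp
  also have "(\<Sum>k\<le>Suc n. of_real (poly (?D k) x) / ?w ^ k) = boundary_sum n x"
    unfolding sum.atMost_Suc boundary_sum_def \<open>?D (Suc n) = 0\<close> by simp
  finally show ?thesis .
qed

text \<open>Only an oscillatory integral over a compact interval remains to be estimated; in the variable
\<open>x = cos t\<close> it is the integral of \<open>exp (-\<i> n x) T x\<close> over \<open>[-1, 1]\<close>.\<close>
lemma G_reflection_integral:
  assumes "n \<ge> 1"
  shows "((\<lambda>t. exp (- \<i> * of_nat n * of_real (cos t)) * of_real (cos (real n * t) * sin t))
      has_integral (\<i> / of_nat n * (G n - (-1) ^ n * cnj (G n)))) {0..pi}"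
proof -
  let ?w = "\<i> * of_nat n :: complex"
  \<comment> \<open>In the variable \<open>x = cos t\<close> this is the antiderivative of \<open>- exp (-\<i> n x) T x\<close>, since
      \<open>x\<close> decreases as \<open>t\<close> grows.\<close>
  define F where "F t = exp (- ?w * of_real (cos t)) * boundary_sum n (cos t) / ?w" for t
  have w: "?w \<noteq> 0" using assms by simp
  have "((\<lambda>t. exp (- ?w * of_real (cos t)) * of_real (cos (real n * t) * sin t))
      has_integral (F pi - F 0)) {0..pi}"
  proof (rule fundamental_theorem_of_calculus)
    fix t :: real
    have c: "((\<lambda>t. of_real (cos t)) has_vector_derivative complex_of_real (- sin t)) (at t within {0..pi})"
      by (rule has_vector_derivative_of_real) (auto intro!: derivative_eq_intros)
    have "((\<lambda>t. exp (- ?w * of_real (cos t))) has_vector_derivative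
        (exp (- ?w * of_real (cos t)) * (- ?w * of_real (- sin t)))) (at t within {0..pi})"
      using field_vector_diff_chain_within[OF has_vector_derivative_mult_right[OF c, of "- ?w"]
          DERIV_subset[OF DERIV_exp]]
      by (simp add: o_def mult_ac)
    moreover have "((\<lambda>t. boundary_sum n (cos t)) has_vector_derivative
        (- sin t) *\<^sub>R (?w * (boundary_sum n (cos t) - of_real (poly (chebyshev n) (cos t))))) (at t within {0..pi})"
    proof -
      have "(cos has_vector_derivative - sin t) (at t within {0..pi})"
        by (auto simp: has_real_derivative_iff_has_vector_derivative[symmetric] intro!: derivative_eq_intros)
      from vector_diff_chain_within[OF this has_vector_derivative_at_within[OF boundary_sum_has_vector_derivative[OF assms]]]
      show ?thesis by (simp only: o_def)
    qed
    ultimately have "(F has_vector_derivative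
       (exp (- ?w * of_real (cos t)) * ((- sin t) *\<^sub>R (?w * (boundary_sum n (cos t) - of_real (poly (chebyshev n) (cos t)))))
        + exp (- ?w * of_real (cos t)) * (- ?w * of_real (- sin t)) * boundary_sum n (cos t)) / ?w) (at t within {0..pi})"
      unfolding F_def by (intro has_vector_derivative_divide has_vector_derivative_mult)
    also have "(exp (- ?w * of_real (cos t)) * ((- sin t) *\<^sub>R (?w * (boundary_sum n (cos t) - of_real (poly (chebyshev n) (cos t)))))
        + exp (- ?w * of_real (cos t)) * (- ?w * of_real (- sin t)) * boundary_sum n (cos t)) / ?w
      = exp (- ?w * of_real (cos t)) * of_real (cos (real n * t) * sin t)"
      using w unfolding poly_chebyshev_cos by (simp add: divide_eq_eq scaleR_conv_of_real) (simp add: algebra_simps)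
    finally show "(F has_vector_derivative exp (- ?w * of_real (cos t)) * of_real (cos (real n * t) * sin t)) (at t within {0..pi})" .
  qed simp
  moreover have "F pi - F 0 = \<i> / of_nat n * (G n - (-1) ^ n * cnj (G n))"
    using assms by (simp add: F_def boundary_sum_endpoints G_def exp_cnj field_simps)
  ultimately show ?thesis by simp
qed

section \<open>The cubic exponential integral\<close>

lemma has_integral_open_halfline:
  fixes f :: "real \<Rightarrow> real"
  shows "(f has_integral I) {0<..} \<longleftrightarrow> (f has_integral I) {0..}"
  by (rule has_integral_spike_set_eq) (auto intro: negligible_subset[of "{0}"])

text \<open>The substitution \<open>u = c s^3\<close> in the Euler integral of \<open>Gamma (1/3)\<close>.\<close>
lemma cubic_exp_integral:
  assumes "c > (0::real)"
  shows "((\<lambda>s. exp (- c * s ^ 3)) has_integral (Gamma (1/3) / (3 * c powr (1/3)))) {0..}"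
proof -
  define f where "f t = t powr (1/3 - 1) / exp t" for t :: real
  define g where "g s = c * s ^ 3" for s :: real
  have inj: "inj_on g {0<..}"
    using assms by (auto simp: inj_on_def g_def power_eq_iff_eq_base)
  have image: "g ` {0<..} = {0<..}"
  proof
    show "{0<..} \<subseteq> g ` {0<..}"
    proof
      fix u :: real assume "u \<in> {0<..}"
      then have "g (root 3 (u / c)) = u" "root 3 (u / c) \<in> {0<..}"
        using assms by (auto simp: g_def odd_real_root_pow)
      then show "u \<in> g ` {0<..}" by (metis imageI)
    qed
  qed (use assms in \<open>auto simp: g_def\<close>)
  have "(f has_integral Gamma (1/3)) {0..}"
    unfolding f_def using Gamma_integral_real[of "1/3"] by simp
  then have f_int: "(f has_integral Gamma (1/3)) {0<..}"
    by (simp add: has_integral_open_halfline)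
  then have "f absolutely_integrable_on {0<..}"
    by (intro nonnegative_absolutely_integrable_1) (auto simp: f_def)
  with f_int have abs: "f absolutely_integrable_on g ` {0<..} \<and> integral (g ` {0<..}) f = Gamma (1/3)"
    by (auto simp: image)
  have der: "(g has_field_derivative 3 * c * s\<^sup>2) (at s within {0<..})" for s
    unfolding g_def by (auto intro!: derivative_eq_intros)
  have "(\<lambda>s. \<bar>3 * c * s\<^sup>2\<bar> * f (g s)) absolutely_integrable_on {0<..} \<and>
        integral {0<..} (\<lambda>s. \<bar>3 * c * s\<^sup>2\<bar> * f (g s)) = Gamma (1/3)"
    using abs by (subst has_absolute_integral_change_of_variables_1'[where g = g]) (use der inj in auto)
  then have "((\<lambda>s. \<bar>3 * c * s\<^sup>2\<bar> * f (g s)) has_integral Gamma (1/3)) {0<..}"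
    by (auto simp: absolutely_integrable_on_def has_integral_iff)
  then have "((\<lambda>s. 3 * c powr (1/3) * exp (- c * s ^ 3)) has_integral Gamma (1/3)) {0<..}"
  proof (rule has_integral_eq[rotated])
    fix s :: real assume "s \<in> {0<..}"
    then have s: "s > 0" by simp
    have "(s ^ 3) powr (1/3 - 1) = s powr (-2)"
      using s by (simp add: powr_powr flip: powr_numeral)
    also have "\<dots> = 1 / s\<^sup>2"
      using s by (simp add: powr_minus divide_inverse)
    finally have "f (g s) = c powr (1/3 - 1) / s\<^sup>2 / exp (c * s ^ 3)"
      using s assms by (simp add: f_def g_def powr_mult)
    moreover have "c * c powr (1/3 - 1) = c powr (1/3)"
      using assms powr_add[of c 1 "1/3 - 1"] by simp
    ultimately show "\<bar>3 * c * s\<^sup>2\<bar> * f (g s) = 3 * c powr (1/3) * exp (- c * s ^ 3)"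
      using s assms by (simp add: exp_minus field_simps)
  qed
  from has_integral_mult_right[OF this, of "1 / (3 * c powr (1/3))"]
  have "((\<lambda>s. exp (- c * s ^ 3)) has_integral (Gamma (1/3) / (3 * c powr (1/3)))) {0<..}"
    using assms by simp
  then show ?thesis
    by (simp add: has_integral_open_halfline)
qed

section \<open>The phase near its degenerate stationary point\<close>

definition phase :: "complex \<Rightarrow> complex" where "phase z = z - sin z"

text \<open>The direction of steepest descent: its argument is \<open>\<pi>/6\<close>, so its cube is a positive multiple of
\<open>\<i>\<close>. It is scaled to imaginary part \<open>1\<close>, so that the parameter along the ray is the height above
the real axis.\<close>
abbreviation ray :: complex where "ray \<equiv> Complex (sqrt 3) 1"

lemma sinh_le_cubic:
  assumes "0 \<le> t" "t \<le> (1::real)"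
  shows "sinh t \<le> t + t ^ 3 / 2"
proof -
  obtain u where u: "\<bar>u\<bar> \<le> \<bar>t\<bar>" "exp t = (\<Sum>m<3. t ^ m / fact m) + exp u / fact 3 * t ^ 3"
    using Maclaurin_exp_le by blast
  obtain v where v: "\<bar>v\<bar> \<le> \<bar>- t\<bar>" "exp (- t) = (\<Sum>m<3. (- t) ^ m / fact m) + exp v / fact 3 * (- t) ^ 3"
    using Maclaurin_exp_le by blast
  have "exp u \<le> 3" "exp v \<le> 3"
    using u(1) v(1) assms by (auto intro!: order_trans[OF _ exp_le])
  then have "(exp u + exp v) * t ^ 3 \<le> 6 * t ^ 3"
    using assms by (intro mult_right_mono) auto
  moreover have "sinh t = t + (exp u + exp v) * t ^ 3 / 12"
    unfolding sinh_field_def u(2) v(2) by (simp add: lessThan_nat_numeral fact_numeral field_simps)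
  ultimately show ?thesis by simp
qed

lemma cos_le_quadratic:
  assumes "0 \<le> t" "t \<le> (1::real)"
  shows "cos (sqrt 3 * t) \<le> 1 - t ^ 2"
proof (cases "t = 0")
  case False
  then have "sqrt 3 * t > 0" using assms by simp
  from Maclaurin_cos_expansion2[OF this, of 4]
  obtain u where u: "cos (sqrt 3 * t) = (\<Sum>m<4. cos_coeff m * (sqrt 3 * t) ^ m)
      + cos (u + 1/2 * real 4 * pi) / fact 4 * (sqrt 3 * t) ^ 4"
    by auto
  have sqrt3: "sqrt 3 ^ 2 = (3::real)" "sqrt 3 ^ 4 = (9::real)"
    using power_mult[of "sqrt 3" 2 2] by simp_all
  have "cos (sqrt 3 * t) = 1 - 3 / 2 * t ^ 2 + cos (u + 1/2 * real 4 * pi) * (3 / 8 * t ^ 4)"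
    unfolding u by (simp add: lessThan_nat_numeral cos_coeff_def fact_numeral power_mult_distrib sqrt3)
  also have "\<dots> \<le> 1 - 3 / 2 * t ^ 2 + 1 * (3 / 8 * t ^ 4)"
    by (intro add_left_mono mult_right_mono cos_le_one) auto
  also have "t ^ 4 \<le> t ^ 2"
    using assms by (intro power_decreasing) auto
  finally show ?thesis using zero_le_power2[of t] by linarith
qed simp

lemma norm_ray: "norm ray = 2"
  by (simp add: cmod_def)

lemma ray_cubed: "ray ^ 3 = 8 * \<i>"
  by (simp add: complex_eq_iff power3_eq_cube)

text \<open>Decay of the exponential along the whole segment, up to real part \<open>\<pi>/2\<close>, with a rate that survives
the scaling by \<open>n powr (1/3)\<close>. The imaginary part is \<open>t - cos (sqrt 3 * t) * sinh t\<close>, and the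
bounds on \<open>sinh\<close> and \<open>cos\<close> apply because the segment stays below height \<open>1\<close>.\<close>
lemma Im_phase_ray:
  assumes "0 \<le> t" "sqrt 3 * t \<le> pi / 2"
  shows "Im (phase (of_real t * ray)) \<ge> 1 / 2 * t ^ 3"
proof -
  have "t \<le> 1"
  proof (rule ccontr)
    assume "\<not> t \<le> 1"
    then have "sqrt 3 \<le> sqrt 3 * t" by simp
    moreover have "sqrt 3 > 1.7" by (rule real_less_rsqrt) (simp add: power2_eq_square)
    moreover have "pi < 3.4" using pi_approx by simp
    ultimately show False using assms(2) by linarith
  qed
  have "cos (sqrt 3 * t) * sinh t \<le> (1 - t\<^sup>2) * (t + t ^ 3 / 2)"
    using assms \<open>t \<le> 1\<close> cos_ge_zero[of "sqrt 3 * t"]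
    by (intro mult_mono cos_le_quadratic sinh_le_cubic) (auto simp: power_le_one sinh_real_nonneg_iff)
  also have "\<dots> \<le> t - 1 / 2 * t ^ 3"
    using assms by (simp add: algebra_simps power2_eq_square power3_eq_cube)
  finally show ?thesis
    by (simp add: phase_def Im_sin sinh_field_def mult.commute)
qed

text \<open>Taylor's formula: \<open>z - sin z\<close> differs from \<open>z^3/6\<close> by \<open>O(z^5)\<close>, which after scaling leaves an error
of order \<open>n * n powr (-5/3)\<close>.\<close>
lemma phase_cubic_limit:
  "(\<lambda>n. of_nat n * phase (z / of_real (real n powr (1/3)))) \<longlonglongrightarrow> z ^ 3 / 6"
proof (rule LIM_zero_cancel)
  let ?m = "\<lambda>n. real n powr (1/3)"
  let ?d = "\<lambda>n. of_nat n * phase (z / of_real (?m n)) - z ^ 3 / 6"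
  have "\<forall>\<^sub>F n in sequentially. norm (?d n) \<le> exp \<bar>Im z\<bar> * norm z ^ 5 / 24 * real n powr (-2/3)"
    using eventually_ge_at_top[of 1]
  proof eventually_elim
    case (elim n)
    define m where "m = ?m n"
    have m: "m \<ge> 1" and m3: "m ^ 3 = real n"
      using elim by (auto simp: m_def ge_one_powr_ge_zero powr_power)
    define w where "w = z / of_real m"
    have z: "z = of_real m * w" using m by (simp add: w_def)
    have "(\<Sum>k\<le>4. complex_of_real (sin_coeff k) * w ^ k) = w - w ^ 3 / 6"
      by (simp add: atMost_nat_numeral sin_coeff_def fact_numeral)
    then have taylor: "norm (sin w - (w - w ^ 3 / 6)) \<le> exp \<bar>Im w\<bar> * norm w ^ 5 / 24"
      using Taylor_sin[of w 4] by (simp add: fact_numeral)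
    have "\<bar>Im w\<bar> \<le> \<bar>Im z\<bar>"
      using m by (simp add: z abs_mult mult_le_cancel_right1)
    have "z ^ 3 = of_nat n * w ^ 3"
    proof -
      have "z ^ 3 = of_real (m ^ 3) * w ^ 3" by (simp add: z power_mult_distrib)
      then show ?thesis by (simp add: m3)
    qed
    then have "?d n = - (of_nat n * (sin w - (w - w ^ 3 / 6)))"
      unfolding m_def[symmetric] w_def[symmetric] phase_def by (simp add: algebra_simps)
    then have "norm (?d n) = real n * norm (sin w - (w - w ^ 3 / 6))"
      by (simp add: norm_mult)
    also have "\<dots> \<le> real n * (exp \<bar>Im z\<bar> * norm w ^ 5 / 24)"
      using \<open>\<bar>Im w\<bar> \<le> \<bar>Im z\<bar>\<close>
      by (intro mult_left_mono order_trans[OF taylor] divide_right_mono mult_right_mono) auto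
    also have "\<dots> = exp \<bar>Im z\<bar> * norm z ^ 5 / 24 * (m ^ 3 / m ^ 5)"
      using m by (simp add: m3 z norm_mult power_mult_distrib)
    also have "m ^ 3 / m ^ 5 = real n powr (-2/3)"
    proof -
      have "m ^ 3 / m ^ 5 = 1 / m ^ 2"
        using m by (simp add: divide_simps flip: power_add)
      also have "m ^ 2 = real n powr (2/3)"
        using elim by (simp add: m_def powr_power)
      finally show ?thesis by (simp add: powr_minus_divide)
    qed
    finally show ?case .
  qed
  moreover have "(\<lambda>n. exp \<bar>Im z\<bar> * norm z ^ 5 / 24 * real n powr (-2/3)) \<longlonglongrightarrow> 0"
    by (intro tendsto_mult_right_zero tendsto_neg_powr filterlim_real_sequentially) auto
  ultimately show "?d \<longlonglongrightarrow> 0"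
    by (rule Lim_null_comparison)
qed

section \<open>The integral along the ray\<close>

definition osc :: "nat \<Rightarrow> complex \<Rightarrow> complex" where
  "osc n z = exp (\<i> * of_nat n * phase z) * cos z"

text \<open>The height at which the ray from the origin reaches the vertical line through \<open>\<pi>/2\<close>.\<close>
definition ray_end :: real where "ray_end = pi / (2 * sqrt 3)"

lemma norm_osc: "norm (osc n z) \<le> exp (- real n * Im (phase z)) * exp (norm z)"
  by (simp add: osc_def norm_mult norm_cos_le)

text \<open>The factor \<open>exp \<pi>\<close> is a crude bound for the cosine: every point of the segment has modulus at
most \<open>\<pi>\<close>.\<close>
lemma norm_osc_ray:
  assumes "0 \<le> t" "t \<le> ray_end"
  shows "norm (osc n (of_real t * ray)) \<le> exp (- (1/2) * (real n * t ^ 3)) * exp pi"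
proof -
  have t: "sqrt 3 * t \<le> pi / 2"
    using assms by (simp add: ray_end_def field_simps)
  have "1 * t \<le> sqrt 3 * t" using assms by (intro mult_right_mono) auto
  then have "norm (of_real t * ray) \<le> pi"
    using t assms norm_ray by (simp add: norm_mult)
  moreover have "real n * (1/2 * t ^ 3) \<le> real n * Im (phase (of_real t * ray))"
    using Im_phase_ray[OF assms(1) t] by (intro mult_left_mono) auto
  ultimately show ?thesis
    by (intro order_trans[OF norm_osc] mult_mono) auto
qed

text \<open>The dominating function for the scaled integrands is independent of \<open>n\<close>.\<close>
lemma norm_osc_scaled_ray:
  assumes "0 \<le> s" "s \<le> ray_end * real n powr (1/3)"
  shows "norm (osc n (of_real (s / real n powr (1/3)) * ray)) \<le> exp (- (1/2) * s ^ 3) * exp pi"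
proof (cases "n = 0")
  case False
  define m where "m = real n powr (1/3)"
  have m: "m > 0" and m3: "m ^ 3 = real n"
    using False by (auto simp: m_def powr_power)
  have "s / m \<le> ray_end"
    using assms(2) m unfolding m_def[symmetric] by (simp add: pos_divide_le_eq)
  then have "norm (osc n (of_real (s / m) * ray)) \<le> exp (- (1/2) * (real n * (s / m) ^ 3)) * exp pi"
    using assms m by (intro norm_osc_ray) auto
  also have "real n * (s / m) ^ 3 = s ^ 3"
    using m by (simp add: power_divide m3[symmetric])
  finally show ?thesis unfolding m_def .
qed (use assms in \<open>auto simp: osc_def phase_def\<close>)

lemma osc_scaled_ray_tendsto:
  "(\<lambda>n. osc n (of_real (s / real n powr (1/3)) * ray)) \<longlonglongrightarrow> of_real (exp (- (4/3) * s ^ 3))"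
proof -
  let ?z = "\<lambda>n. of_real s * ray / of_real (real n powr (1/3))"
  have "\<i> * ((of_real s * ray) ^ 3 / 6) = of_real (- (4/3) * s ^ 3)"
  proof -
    have "\<i> * (x * (8 * \<i>) / 6) = - (4/3) * x" for x :: complex
      by (simp add: complex_eq_iff)
    then show ?thesis
      unfolding power_mult_distrib ray_cubed by (simp only: of_real_mult of_real_minus of_real_power of_real_divide of_real_numeral)
  qed
  moreover have "(\<lambda>n. \<i> * (of_nat n * phase (?z n))) \<longlonglongrightarrow> \<i> * ((of_real s * ray) ^ 3 / 6)"
    by (intro tendsto_mult tendsto_const phase_cubic_limit)
  ultimately have phase_lim: "(\<lambda>n. \<i> * (of_nat n * phase (?z n))) \<longlonglongrightarrow> of_real (- (4/3) * s ^ 3)"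
    by (simp only:)
  have z_lim: "?z \<longlonglongrightarrow> 0"
  proof -
    have "(\<lambda>n. real n powr - (1/3)) \<longlonglongrightarrow> 0"
      by (intro tendsto_neg_powr filterlim_real_sequentially) auto
    then have "(\<lambda>n. of_real s * ray * of_real (real n powr - (1/3))) \<longlonglongrightarrow> of_real s * ray * of_real 0"
      by (intro tendsto_mult tendsto_const tendsto_of_real)
    then show ?thesis by (simp add: powr_minus_divide)
  qed
  have "(\<lambda>n. exp (\<i> * (of_nat n * phase (?z n))) * cos (?z n))
      \<longlonglongrightarrow> exp (of_real (- (4/3) * s ^ 3)) * cos 0"
    by (intro tendsto_mult tendsto_exp tendsto_cos phase_lim z_lim)
  moreover have "osc n (of_real (s / real n powr (1/3)) * ray)
      = exp (\<i> * (of_nat n * phase (?z n))) * cos (?z n)" for n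
    by (simp add: osc_def mult.assoc)
  moreover have "exp (of_real (- (4/3) * s ^ 3)) * cos 0 = complex_of_real (exp (- (4/3) * s ^ 3))"
    by (simp only: exp_of_real cos_zero mult_1_right)
  ultimately show ?thesis by (simp only:)
qed

text \<open>Dominated convergence on the half-line, with the scaled integrands extended by zero beyond the end
of the segment, which moves to infinity.\<close>
lemma ray_integral_limit:
  "(\<lambda>n. integral {0..ray_end * real n powr (1/3)}
          (\<lambda>s. ray * osc n (of_real (s / real n powr (1/3)) * ray)))
     \<longlonglongrightarrow> ray * of_real (Gamma (1/3) / (3 * (4/3) powr (1/3)))"
proof -
  define h where "h n s = ray * osc n (of_real (s / real n powr (1/3)) * ray)" for n s
  define I where "I n = {0..ray_end * real n powr (1/3)}" for n
  define H where "H n s = (if s \<in> I n then h n s else 0)" for n s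
  define g where "g s = ray * of_real (exp (- (4/3) * s ^ 3))" for s :: real
  have sub: "I n \<inter> {0..} = I n" for n by (auto simp: I_def)
  have H_eq: "integral {0..} (H n) = integral (I n) (h n)" for n
    unfolding H_def by (subst integral_restrict_Int) (simp add: sub)
  have H_int: "H n integrable_on {0..}" for n
  proof -
    have "continuous_on (I n) (h n)"
      unfolding h_def osc_def phase_def I_def by (cases "n = 0") (auto intro!: continuous_intros)
    then have "h n integrable_on I n"
      unfolding I_def by (rule integrable_continuous_interval)
    then show ?thesis
      unfolding H_def by (subst integrable_restrict_Int) (simp add: sub)
  qed
  have "(\<lambda>n. integral {0..} (H n)) \<longlonglongrightarrow> integral {0..} g"
  proof (rule dominated_convergence(2)[where h = "\<lambda>s. 2 * exp pi * exp (- (1/2) * s ^ 3)"])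
    show "(\<lambda>s. 2 * exp pi * exp (- (1/2) * s ^ 3)) integrable_on {0..}"
      by (intro integrable_on_mult_right has_integral_integrable[OF cubic_exp_integral]) simp
    show "norm (H n s) \<le> 2 * exp pi * exp (- (1/2) * s ^ 3)" for n s
    proof (cases "s \<in> I n")
      case True
      then have "norm (H n s) = 2 * norm (osc n (of_real (s / real n powr (1/3)) * ray))"
        by (simp only: H_def h_def if_True norm_mult norm_ray)
      also have "\<dots> \<le> 2 * (exp (- (1/2) * s ^ 3) * exp pi)"
        using True by (intro mult_left_mono norm_osc_scaled_ray) (auto simp: I_def)
      finally show ?thesis by (simp only: mult_ac)
    qed (simp add: H_def)
    show "(\<lambda>n. H n s) \<longlonglongrightarrow> g s" if "s \<in> {0..}" for s
    proof (rule Lim_transform_eventually)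
      show "(\<lambda>n. h n s) \<longlonglongrightarrow> g s"
        unfolding h_def g_def by (intro tendsto_mult tendsto_const osc_scaled_ray_tendsto)
      have "filterlim (\<lambda>n. ray_end * real n powr (1/3)) at_top sequentially"
        unfolding ray_end_def by real_asymp
      then have "\<forall>\<^sub>F n in sequentially. s \<le> ray_end * real n powr (1/3)"
        by (simp add: filterlim_at_top)
      then show "\<forall>\<^sub>F n in sequentially. h n s = H n s"
        by eventually_elim (use that in \<open>auto simp: H_def I_def\<close>)
    qed
  qed (rule H_int)
  moreover have "(g has_integral ray * of_real (Gamma (1/3) / (3 * (4/3) powr (1/3)))) {0..}"
    unfolding g_def
    by (intro has_integral_mult_right has_integral_of_real cubic_exp_integral) simp
  ultimately show ?thesis
    unfolding H_eq h_def I_def by (simp only: integral_unique)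
qed

section \<open>Moving the contour\<close>

text \<open>The integrand is entire. With an antiderivative at hand, deforming the contour only means
evaluating that function at the corners.\<close>
lemma osc_has_primitive: "\<exists>F. \<forall>z. (F has_field_derivative osc n z) (at z)"
proof -
  have "osc n holomorphic_on UNIV"
    unfolding osc_def phase_def by (intro holomorphic_intros)
  from holomorphic_convex_primitive'[OF convex_UNIV open_UNIV this]
  show ?thesis by (metis UNIV_I)
qed

lemma has_integral_along_line:
  fixes F f :: "complex \<Rightarrow> complex"
  assumes "\<And>z. (F has_field_derivative f z) (at z)" and "0 \<le> b"
  shows "((\<lambda>t. d * f (a + of_real t * d)) has_integral (F (a + of_real b * d) - F a)) {0..b}"
proof -
  have "((\<lambda>t. F (a + of_real t * d)) has_vector_derivative d * f (a + of_real t * d)) (at t within {0..b})" for t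
  proof -
    have "((\<lambda>t. a + of_real t * d) has_vector_derivative 0 + of_real 1 * d) (at t within {0..b})"
      by (intro has_vector_derivative_add has_vector_derivative_const has_vector_derivative_mult_left
            has_vector_derivative_of_real DERIV_ident)
    from field_vector_diff_chain_within[OF this DERIV_subset[OF assms(1)]]
    show ?thesis by (simp add: o_def)
  qed
  from fundamental_theorem_of_calculus[OF assms(2) this] show ?thesis by simp
qed

definition osc_integral :: "nat \<Rightarrow> complex" where
  "osc_integral n = integral {0..pi/2} (\<lambda>u. osc n (of_real u))"

text \<open>On this line \<open>Re (cos z)\<close> and \<open>Im (sin z)\<close> vanish, so the imaginary part of \<open>z - sin z\<close> is the
height \<open>y\<close> itself.\<close>
lemma norm_osc_vertical:
  assumes "0 \<le> y" "y \<le> ray_end"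
  shows "norm (osc n (of_real (pi/2) + of_real y * \<i>)) \<le> exp pi * exp (- real n * y)"
proof -
  have "ray_end \<le> pi / 2"
    by (simp add: ray_end_def field_simps)
  have "norm (of_real (pi/2) + of_real y * \<i>) \<le> pi/2 + y"
    using assms by (intro order_trans[OF norm_triangle_ineq]) (simp add: norm_mult)
  also have "\<dots> \<le> pi" using assms \<open>ray_end \<le> pi / 2\<close> by simp
  finally have "exp (norm (of_real (pi/2) + of_real y * \<i>)) \<le> exp pi" by simp
  moreover have "Im (phase (of_real (pi/2) + of_real y * \<i>)) = y"
    by (simp add: phase_def Im_sin)
  ultimately have "exp (- real n * Im (phase (of_real (pi/2) + of_real y * \<i>)))
      * exp (norm (of_real (pi/2) + of_real y * \<i>)) \<le> exp (- real n * y) * exp pi"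
    by (intro mult_mono) auto
  from order_trans[OF norm_osc this] show ?thesis
    by (simp only: mult.commute)
qed

text \<open>The error is the integral over the vertical piece, at most the integral of
\<open>exp \<pi> * exp (- n y)\<close>, hence \<open>O(1/n)\<close>; the scaling multiplies it by \<open>n powr (1/3)\<close>.\<close>
lemma contour_shift_error:
  assumes "n \<ge> 1"
  shows "norm (of_real (real n powr (1/3)) * osc_integral n
      - integral {0..ray_end * real n powr (1/3)} (\<lambda>s. ray * osc n (of_real (s / real n powr (1/3)) * ray)))
    \<le> exp pi * real n powr (-2/3)"
proof -
  define m where "m = real n powr (1/3)"
  have m: "m > 0" using assms by (simp add: m_def)
  have r: "ray_end > 0" by (simp add: ray_end_def)
  obtain F where "\<forall>z. (F has_field_derivative osc n z) (at z)"
    using osc_has_primitive ..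
  then have F: "\<And>z. (F has_field_derivative osc n z) (at z)" ..
  define q where "q = of_real ray_end * ray"
  have q: "q = of_real (pi/2) + of_real ray_end * \<i>"
    by (simp add: q_def complex_eq_iff ray_end_def)
  have horizontal: "osc_integral n = F (of_real (pi/2)) - F 0"
    using has_integral_along_line[OF F, of "pi/2" 1 0] by (simp add: osc_integral_def integral_unique)
  have diagonal: "integral {0..ray_end * m} (\<lambda>s. ray * osc n (of_real (s / m) * ray)) = of_real m * (F q - F 0)"
  proof -
    have "((\<lambda>s. of_real m * (ray / of_real m * osc n (0 + of_real s * (ray / of_real m))))
        has_integral of_real m * (F (0 + of_real (ray_end * m) * (ray / of_real m)) - F 0)) {0..ray_end * m}"
      using m r by (intro has_integral_mult_right has_integral_along_line F) auto
    then have "((\<lambda>s. ray * osc n (of_real (s / m) * ray)) has_integral of_real m * (F q - F 0)) {0..ray_end * m}"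
      using m by (simp add: q_def)
    then show ?thesis by (rule integral_unique)
  qed
  have vertical: "norm (F q - F (of_real (pi/2))) \<le> exp pi / real n"
  proof -
    let ?f = "\<lambda>y. \<i> * osc n (of_real (pi/2) + of_real y * \<i>)"
    let ?g = "\<lambda>y. exp pi * exp (- real n * y)"
    have f: "(?f has_integral F q - F (of_real (pi/2))) {0..ray_end}"
      using has_integral_along_line[OF F, of ray_end \<i> "of_real (pi/2)"] r by (simp add: q)
    have g: "(?g has_integral (- exp pi / real n * exp (- real n * ray_end)) - (- exp pi / real n * exp (- real n * 0))) {0..ray_end}"
      using assms r
      by (intro fundamental_theorem_of_calculus)
         (auto simp: has_real_derivative_iff_has_vector_derivative[symmetric] intro!: derivative_eq_intros)
    have "norm (integral {0..ray_end} ?f) \<le> integral {0..ray_end} ?g"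
    proof (rule integral_norm_bound_integral)
      show "?f integrable_on {0..ray_end}" "?g integrable_on {0..ray_end}"
        using f g by (auto intro: has_integral_integrable)
      fix y assume "y \<in> {0..ray_end}"
      then have "norm (osc n (of_real (pi/2) + of_real y * \<i>)) \<le> ?g y"
        by (intro norm_osc_vertical) auto
      then show "norm (?f y) \<le> ?g y"
        by (simp only: norm_mult norm_ii mult_1)
    qed
    also have "\<dots> \<le> exp pi / real n"
      unfolding integral_unique[OF g] by simp
    finally show ?thesis unfolding integral_unique[OF f] .
  qed
  have "norm (of_real m * osc_integral n - of_real m * (F q - F 0)) = m * norm (F q - F (of_real (pi/2)))"
  proof -
    have "of_real m * osc_integral n - of_real m * (F q - F 0) = of_real m * (F (of_real (pi/2)) - F q)"
      unfolding horizontal by (simp add: algebra_simps)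
    then show ?thesis using m by (simp add: norm_mult norm_minus_commute)
  qed
  also have "\<dots> \<le> m * (exp pi / real n)"
    using m vertical by (intro mult_left_mono) auto
  also have "\<dots> = exp pi * (m * real n powr (-1))"
    using assms by (simp add: powr_minus field_simps)
  also have "m * real n powr (-1) = real n powr (-2/3)"
    unfolding m_def powr_add[symmetric] by simp
  finally show ?thesis unfolding m_def[symmetric] diagonal .
qed

definition osc_limit :: real where
  "osc_limit = 6 powr (1/3) * Gamma (1/3) / (2 * sqrt 3)"

text \<open>Taking the real part of the limit replaces the factor \<open>sqrt 3 + \<i>\<close> by \<open>sqrt 3\<close>.\<close>
lemma Re_osc_integral_asymptotics:
  "(\<lambda>n. real n powr (1/3) * Re (osc_integral n)) \<longlonglongrightarrow> osc_limit"
proof -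
  let ?R = "\<lambda>n. integral {0..ray_end * real n powr (1/3)} (\<lambda>s. ray * osc n (of_real (s / real n powr (1/3)) * ray))"
  let ?S = "\<lambda>n. of_real (real n powr (1/3)) * osc_integral n"
  have "(\<lambda>n. ?S n - ?R n) \<longlonglongrightarrow> 0"
  proof (rule Lim_null_comparison)
    show "\<forall>\<^sub>F n in sequentially. norm (?S n - ?R n) \<le> exp pi * real n powr (-2/3)"
      using eventually_ge_at_top[of 1] by eventually_elim (rule contour_shift_error)
    show "(\<lambda>n. exp pi * real n powr (-2/3)) \<longlonglongrightarrow> 0"
      by (intro tendsto_mult_right_zero tendsto_neg_powr filterlim_real_sequentially) auto
  qed
  from tendsto_Re[OF tendsto_add[OF this ray_integral_limit]]
  have "(\<lambda>n. real n powr (1/3) * Re (osc_integral n)) \<longlonglongrightarrow> sqrt 3 * (Gamma (1/3) / (3 * (4/3) powr (1/3)))"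
    by simp
  also have "sqrt 3 * (Gamma (1/3) / (3 * (4/3) powr (1/3))) = osc_limit"
  proof -
    have "(6::real) powr (1/3) * (4/3) powr (1/3) = (2 powr 3) powr (1/3)"
      by (subst powr_mult[symmetric]) simp_all
    also have "\<dots> = (2::real)"
      by (simp only: powr_powr) simp
    finally have "(6::real) powr (1/3) * (4/3) powr (1/3) = 2" .
    moreover have "sqrt 3 * sqrt 3 = (3::real)" by simp
    ultimately show ?thesis
      unfolding osc_limit_def by (simp add: field_simps)
  qed
  finally show ?thesis .
qed

section \<open>The stationary and the nonstationary contribution\<close>

lemma osc_of_real:
  "osc n (of_real u) = exp (\<i> * of_nat n * of_real (u - sin u)) * of_real (cos u)"
  by (simp add: osc_def phase_def sin_of_real cos_of_real)

text \<open>With \<open>t = \<pi>/2 + u\<close> the exponent becomes \<open>-\<i> n (\<pi>/2 + u - sin u)\<close>, which explains the factor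
\<open>(-\<i>)^n\<close>. Since \<open>u - sin u\<close> is odd, the two halves of \<open>[-\<pi>/2, \<pi>/2]\<close> contribute conjugate values.\<close>
lemma stationary_integral:
  "((\<lambda>t. exp (- \<i> * of_nat n * of_real (cos t + t)) * of_real (sin t))
     has_integral (- \<i>) ^ n * of_real (2 * Re (osc_integral n))) {0..pi}"
proof -
  obtain F where "\<forall>z. (F has_field_derivative osc n z) (at z)"
    using osc_has_primitive ..
  then have F: "\<And>z. (F has_field_derivative osc n z) (at z)" ..
  have osc_minus: "osc n (- of_real u) = cnj (osc n (of_real u))" for u :: real
    using osc_of_real[of n u] osc_of_real[of n "- u"] by (simp add: exp_cnj right_diff_distrib)
  have right: "((\<lambda>u. osc n (of_real u)) has_integral F (of_real (pi/2)) - F 0) {0..pi/2}"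
    using has_integral_along_line[OF F, of "pi/2" 1 0] by simp
  then have I: "osc_integral n = F (of_real (pi/2)) - F 0"
    by (simp add: osc_integral_def integral_unique)
  have "((\<lambda>u. - cnj (osc n (of_real u))) has_integral F (- of_real (pi/2)) - F 0) {0..pi/2}"
    using has_integral_along_line[OF F, of "pi/2" "-1" 0] by (simp flip: osc_minus)
  moreover have "((\<lambda>u. - cnj (osc n (of_real u))) has_integral - cnj (F (of_real (pi/2)) - F 0)) {0..pi/2}"
    using has_integral_linear[OF right bounded_linear_cnj] by (intro has_integral_neg) (simp only: o_def)
  ultimately have "F (- of_real (pi/2)) - F 0 = - cnj (osc_integral n)"
    unfolding I by (rule has_integral_unique)
  then have total: "cnj (F (of_real (pi/2)) - F (- of_real (pi/2))) = of_real (2 * Re (osc_integral n))"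
    using I by (simp add: complex_eq_iff algebra_simps)
  have "((\<lambda>t. osc n (of_real (t - pi/2))) has_integral F (of_real (pi/2)) - F (- of_real (pi/2))) {0..pi}"
    using has_integral_along_line[OF F, of pi 1 "- of_real (pi/2)"] by (simp add: algebra_simps)
  from has_integral_linear[OF this bounded_linear_cnj]
  have "((\<lambda>t. (- \<i>) ^ n * cnj (osc n (of_real (t - pi/2)))) has_integral
      (- \<i>) ^ n * of_real (2 * Re (osc_integral n))) {0..pi}"
    unfolding total[symmetric] by (intro has_integral_mult_right) (simp only: o_def)
  moreover have "(- \<i>) ^ n * cnj (osc n (of_real (t - pi/2)))
      = exp (- \<i> * of_nat n * of_real (cos t + t)) * of_real (sin t)" for t
  proof -
    have "(- \<i>) ^ n = exp (of_nat n * (- \<i> * of_real (pi/2)))"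
      unfolding exp_of_nat_mult by (simp add: exp_minus exp_eq_polar flip: cis_conv_exp)
    moreover have "osc n (of_real (t - pi/2)) = exp (\<i> * of_nat n * of_real (t - pi/2 + cos t)) * of_real (sin t)"
      unfolding osc_of_real by (simp add: sin_diff cos_diff)
    ultimately show ?thesis
      by (simp add: exp_cnj algebra_simps flip: exp_add)
  qed
  ultimately show ?thesis by simp
qed

text \<open>One integration by parts. The derivative of the phase is \<open>- (1 + sin t)\<close>, of modulus at least \<open>1\<close>,
and the boundary terms vanish because \<open>sin\<close> is zero at \<open>0\<close> and \<open>\<pi>\<close>.\<close>
lemma nonstationary_integral:
  assumes "n \<ge> 1"
  obtains D where "((\<lambda>t. exp (- \<i> * of_nat n * of_real (cos t - t)) * of_real (sin t)) has_integral D) {0..pi}"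
    and "norm D \<le> pi / real n"
proof -
  let ?w = "\<i> * of_nat n :: complex"
  let ?e = "\<lambda>t. exp (- ?w * of_real (cos t - t))"
  let ?c = "\<lambda>t. ?e t * of_real (cos t / (1 + sin t)\<^sup>2) / ?w"
  have w: "?w \<noteq> 0" using assms by simp
  have pos: "1 + sin t \<ge> 1" if "t \<in> {0..pi}" for t
    using that by (simp add: sin_ge_zero)
  have "continuous_on {0..pi} ?c"
    using w pos by (intro continuous_intros) (auto, fastforce)
  then have c: "(?c has_integral integral {0..pi} ?c) {0..pi}"
    by (intro integrable_integral integrable_continuous_interval)
  \<comment> \<open>The weight \<open>sin t / (1 + sin t)\<close> makes the differentiated exponential equal to the given integrand;
      differentiating the weight itself gives the remainder, which carries the factor \<open>1 / n\<close>.\<close>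
  have "((\<lambda>t. ?e t * of_real (sin t) + ?c t) has_integral
      (?e pi * of_real (sin pi / (1 + sin pi)) / ?w - ?e 0 * of_real (sin 0 / (1 + sin 0)) / ?w)) {0..pi}"
  proof (rule fundamental_theorem_of_calculus)
    fix t assume t: "t \<in> {0..pi}"
    have p: "1 + sin t > 0" using pos[OF t] by simp
    have e: "(?e has_vector_derivative ?e t * (- ?w * of_real (- sin t - 1))) (at t within {0..pi})"
    proof -
      have "((\<lambda>t. of_real (cos t - t)) has_vector_derivative complex_of_real (- sin t - 1)) (at t within {0..pi})"
        by (rule has_vector_derivative_of_real) (auto intro!: derivative_eq_intros)
      from field_vector_diff_chain_within[OF has_vector_derivative_mult_right[OF this, of "- ?w"] DERIV_subset[OF DERIV_exp]]
      show ?thesis by (simp add: o_def mult_ac)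
    qed
    have "((\<lambda>t. of_real (sin t / (1 + sin t))) has_vector_derivative complex_of_real (cos t / (1 + sin t)\<^sup>2)) (at t within {0..pi})"
      using p by (intro has_vector_derivative_of_real)
        (auto intro!: derivative_eq_intros simp: field_simps power2_eq_square)
    from has_vector_derivative_divide[OF has_vector_derivative_mult[OF e this]]
    have "((\<lambda>t. ?e t * of_real (sin t / (1 + sin t)) / ?w) has_vector_derivative
        (?e t * of_real (cos t / (1 + sin t)\<^sup>2) + ?e t * (- ?w * of_real (- sin t - 1)) * of_real (sin t / (1 + sin t))) / ?w)
        (at t within {0..pi})" .
    also have "(?e t * of_real (cos t / (1 + sin t)\<^sup>2) + ?e t * (- ?w * of_real (- sin t - 1)) * of_real (sin t / (1 + sin t))) / ?w
        = ?e t * of_real (sin t) + ?c t"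
    proof -
      have "(- sin t - 1) * (sin t / (1 + sin t)) = - sin t"
        using p by (simp add: field_simps)
      then have r: "complex_of_real (- sin t - 1) * of_real (sin t / (1 + sin t)) = - of_real (sin t)"
        by (metis of_real_minus of_real_mult)
      have "?e t * (- ?w * of_real (- sin t - 1)) * of_real (sin t / (1 + sin t))
          = - (?e t * ?w * (complex_of_real (- sin t - 1) * of_real (sin t / (1 + sin t))))"
        by (simp only: mult_ac mult_minus_left mult_minus_right)
      also have "\<dots> = ?e t * of_real (sin t) * ?w"
        unfolding r by simp
      finally show ?thesis using w by (simp add: add_divide_distrib)
    qed
    finally show "((\<lambda>t. ?e t * of_real (sin t / (1 + sin t)) / ?w) has_vector_derivative
        ?e t * of_real (sin t) + ?c t) (at t within {0..pi})" .
  qed simp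
  then have "((\<lambda>t. ?e t * of_real (sin t) + ?c t) has_integral 0) {0..pi}" by simp
  from has_integral_diff[OF this c]
  have "((\<lambda>t. ?e t * of_real (sin t)) has_integral - integral {0..pi} ?c) {0..pi}" by simp
  moreover have "norm (- integral {0..pi} ?c) \<le> pi / real n"
  proof -
    have "norm (integral {0..pi} ?c) \<le> 1 / real n * measure lborel (cbox 0 pi)"
    proof (rule has_integral_bound)
      show "(?c has_integral integral {0..pi} ?c) (cbox 0 pi)" using c by simp
      fix t assume "t \<in> cbox 0 pi"
      then have "1 + sin t \<ge> 1" using pos by simp
      then have "\<bar>cos t\<bar> / (1 + sin t)\<^sup>2 \<le> 1"
        by (simp add: divide_le_eq one_le_power order_trans[OF abs_cos_le_one])
      then have "(\<bar>cos t\<bar> / (1 + sin t)\<^sup>2) / real n \<le> 1 / real n"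
        by (intro divide_right_mono) auto
      then show "norm (?c t) \<le> 1 / real n"
        by (simp only: norm_divide norm_mult norm_of_real) simp
    qed simp
    then show ?thesis by simp
  qed
  moreover have "?e t = exp (- \<i> * of_nat n * of_real (cos t - t))" for t
    by simp
  ultimately show ?thesis by (intro that) (simp_all only:)
qed

section \<open>Asymptotics\<close>

text \<open>The factor \<open>\<i>^(n + 1)\<close> cancels the factor \<open>-\<i>\<close> of the reflection formula and the \<open>(-\<i>)^n\<close> of the
stationary contribution. The remaining main term is \<open>n * Re (osc_integral n)\<close>, and the nonstationary
contribution is bounded before division by \<open>n powr (2/3)\<close>.\<close>
lemma G_reflection_asymptotics:
  "(\<lambda>n. Re (\<i> ^ (n + 1) * (G n - (-1) ^ n * cnj (G n))) / real n powr (2/3)) \<longlonglongrightarrow> osc_limit"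
proof -
  let ?W = "\<lambda>n. G n - (-1) ^ n * cnj (G n)"
  let ?v = "\<lambda>n. Re (\<i> ^ (n + 1) * ?W n) / real n powr (2/3)"
  let ?u = "\<lambda>n. real n powr (1/3) * Re (osc_integral n)"
  have "(\<lambda>n. ?v n - ?u n) \<longlonglongrightarrow> 0"
  proof (rule Lim_null_comparison)
    show "(\<lambda>n. pi / 2 * real n powr (-2/3)) \<longlonglongrightarrow> 0"
      by (intro tendsto_mult_right_zero tendsto_neg_powr filterlim_real_sequentially) auto
    show "\<forall>\<^sub>F n in sequentially. norm (?v n - ?u n) \<le> pi / 2 * real n powr (-2/3)"
      using eventually_ge_at_top[of 1]
    proof eventually_elim
      case (elim n)
      obtain D where D: "((\<lambda>t. exp (- \<i> * of_nat n * of_real (cos t - t)) * of_real (sin t)) has_integral D) {0..pi}"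
        and D_le: "norm D \<le> pi / real n"
        using nonstationary_integral[OF elim] .
      have product: "exp (- \<i> * of_nat n * of_real (cos t)) * of_real (cos (real n * t) * sin t)
          = (exp (- \<i> * of_nat n * of_real (cos t + t)) * of_real (sin t)
            + exp (- \<i> * of_nat n * of_real (cos t - t)) * of_real (sin t)) / 2" for t
      proof -
        have "complex_of_real (cos (real n * t)) = (exp (\<i> * (of_nat n * of_real t)) + exp (- (\<i> * (of_nat n * of_real t)))) / 2"
        proof -
          have "complex_of_real (cos x) = (exp (\<i> * of_real x) + exp (- (\<i> * of_real x))) / 2" for x
            unfolding cos_of_real[symmetric] cos_exp_eq ..
          from this[of "real n * t"] show ?thesis by simp
        qed
        moreover have "exp (- \<i> * of_nat n * of_real (cos t + t))
            = exp (- \<i> * of_nat n * of_real (cos t)) * exp (- (\<i> * (of_nat n * of_real t)))"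
          by (simp add: algebra_simps flip: exp_add)
        moreover have "exp (- \<i> * of_nat n * of_real (cos t - t))
            = exp (- \<i> * of_nat n * of_real (cos t)) * exp (\<i> * (of_nat n * of_real t))"
          by (simp add: algebra_simps flip: exp_add)
        ultimately show ?thesis
          by (simp only: of_real_mult) (simp add: algebra_simps add_divide_distrib)
      qed
      have "((\<lambda>t. exp (- \<i> * of_nat n * of_real (cos t)) * of_real (cos (real n * t) * sin t)) has_integral
          ((- \<i>) ^ n * of_real (2 * Re (osc_integral n)) + D) / 2) {0..pi}"
        unfolding product by (intro has_integral_divide has_integral_add stationary_integral D)
      with G_reflection_integral[OF elim]
      have "\<i> / of_nat n * ?W n = ((- \<i>) ^ n * of_real (2 * Re (osc_integral n)) + D) / 2"
        by (rule has_integral_unique)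
      then have W': "\<i> * ?W n = of_nat n * ((- \<i>) ^ n * of_real (Re (osc_integral n)) + D / 2)"
        using elim by (simp add: field_simps)
      have "\<i> ^ (n + 1) * ?W n = \<i> ^ n * (\<i> * ?W n)"
        by (simp only: power_add power_one_right mult.assoc)
      also have "\<dots> = of_nat n * ((\<i> ^ n * (- \<i>) ^ n) * of_real (Re (osc_integral n))) + \<i> ^ n * of_nat n * D / 2"
        unfolding W' by (simp add: algebra_simps)
      also have "\<i> ^ n * (- \<i>) ^ n = 1"
        by (simp flip: power_mult_distrib)
      finally have W: "\<i> ^ (n + 1) * ?W n = of_real (real n * Re (osc_integral n)) + \<i> ^ n * of_nat n * D / 2"
        by simp
      have "real n / real n powr (2/3) = real n powr (1/3)"
        using elim powr_diff[of "real n" 1 "2/3"] by simp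
      then have "?v n - ?u n = Re (\<i> ^ n * of_nat n * D / 2) / real n powr (2/3)"
        unfolding W by (simp add: add_divide_distrib flip: times_divide_eq_left)
      also have "norm \<dots> \<le> (pi / 2) / real n powr (2/3)"
      proof -
        have "\<bar>Re (\<i> ^ n * of_nat n * D / 2)\<bar> \<le> norm (\<i> ^ n * of_nat n * D / 2)"
          by (rule abs_Re_le_cmod)
        also have "\<dots> = real n * norm D / 2"
          by (simp add: norm_mult norm_divide norm_power)
        also have "\<dots> \<le> pi / 2"
          using D_le elim by (simp add: field_simps)
        finally show ?thesis
          by (simp only: real_norm_def abs_divide) (simp add: divide_right_mono del: Re_divide_numeral)
      qed
      finally show ?case by (simp add: powr_minus_divide)
    qed
  qed
  from tendsto_add[OF this Re_osc_integral_asymptotics] show ?thesis by simp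
qed

lemma osc_limit_nonzero: "osc_limit \<noteq> 0"
proof -
  have "Gamma (1/3 :: real) > 0" by (rule Gamma_real_pos) simp
  then have "Gamma (1/3 :: real) \<noteq> 0" by linarith
  then show ?thesis by (simp add: osc_limit_def)
qed

text \<open>For \<open>n = 2 k\<close> the rotated combination \<open>\<i>^(n + 1) (G n - (-1)^n cnj (G n))\<close> is
\<open>(-1)^(k + 1) 2 Im (G n)\<close>, for \<open>n = 2 k + 1\<close> it is \<open>(-1)^(k + 1) 2 Re (G n)\<close>; both parities follow
from the same limit. The statement on conjugation holds because the Pochhammer symbols are real.\<close>
theorem theorem3:
  shows "((\<lambda>n. Im (G n)) \<sim>[inf at_top (principal {n. even n})]
           (\<lambda>n. - (6 powr (1/3) * Gamma (1/3) * (-1) ^ (n div 2) / (4 * sqrt 3)) * real n powr (2/3))) \<and>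
         ((\<lambda>n. Re (G n)) \<sim>[inf at_top (principal {n. odd n})]
           (\<lambda>n. 6 powr (1/3) * Gamma (1/3) * (-1) ^ ((n + 1) div 2) / (4 * sqrt 3) * real n powr (2/3))) \<and>
         (\<forall>n\<ge>1. exp (\<i> * of_nat n) * hyp3F1 n (- \<i> / (2 * of_nat n)) = cnj (G n))"
proof (intro conjI allI impI)
  let ?v = "\<lambda>n. Re (\<i> ^ (n + 1) * (G n - (-1) ^ n * cnj (G n))) / real n powr (2/3)"
  have "(\<lambda>n. ?v n / osc_limit) \<longlonglongrightarrow> osc_limit / osc_limit"
    by (intro tendsto_divide G_reflection_asymptotics tendsto_const osc_limit_nonzero)
  then have "(\<lambda>n. ?v n / osc_limit) \<longlonglongrightarrow> 1"
    unfolding divide_self[OF osc_limit_nonzero] .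
  then have lim: "((\<lambda>n. ?v n / osc_limit) \<longlongrightarrow> 1) (inf at_top (principal S))" for S
    by (rule tendsto_mono[OF inf_le1])
  have const: "6 powr (1/3) * Gamma (1/3) = osc_limit * (2 * sqrt 3)"
    by (simp add: osc_limit_def)
  show "(\<lambda>n. Im (G n)) \<sim>[inf at_top (principal {n. even n})]
           (\<lambda>n. - (6 powr (1/3) * Gamma (1/3) * (-1) ^ (n div 2) / (4 * sqrt 3)) * real n powr (2/3))"
  proof (rule asymp_equivI'[OF Lim_transform_eventually[OF lim]])
    show "\<forall>\<^sub>F n in inf at_top (principal {n. even n}). ?v n / osc_limit =
        Im (G n) / (- (6 powr (1/3) * Gamma (1/3) * (-1) ^ (n div 2) / (4 * sqrt 3)) * real n powr (2/3))"
      unfolding eventually_inf_principal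
    proof (intro always_eventually allI impI)
      fix n :: nat assume "n \<in> {n. even n}"
      then have "even n" by simp
      then obtain k where n: "n = 2 * k" ..
      have W: "\<i> ^ (n + 1) * (G n - (-1) ^ n * cnj (G n)) = of_real ((-1) ^ Suc k * (2 * Im (G n)))"
      proof -
        have i_power: "\<i> ^ (n + 1) = (-1) ^ k * \<i>"
        proof -
          have "\<i> ^ (n + 1) = \<i> ^ (2 * k) * \<i>"
            by (simp only: n power_add power_one_right)
          also have "\<i> ^ (2 * k) = (-1) ^ k"
            by (simp only: power_mult power2_i)
          finally show ?thesis .
        qed
        have sign: "(-1) ^ n = (1::complex)"
          by (simp add: n)
        have diff: "G n - cnj (G n) = \<i> * of_real (2 * Im (G n))"
          by (simp add: complex_eq_iff)
        show ?thesis
          unfolding i_power sign mult_1 diff by (cases "even k") simp_all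
      qed
      have "?v n = (-1) ^ Suc k * (2 * Im (G n)) / real n powr (2/3)"
        unfolding W Re_complex_of_real ..
      then show "?v n / osc_limit =
          Im (G n) / (- (6 powr (1/3) * Gamma (1/3) * (-1) ^ (n div 2) / (4 * sqrt 3)) * real n powr (2/3))"
        unfolding const by (cases "even k") (simp_all add: n mult.commute)
    qed
  qed
  show "(\<lambda>n. Re (G n)) \<sim>[inf at_top (principal {n. odd n})]
           (\<lambda>n. 6 powr (1/3) * Gamma (1/3) * (-1) ^ ((n + 1) div 2) / (4 * sqrt 3) * real n powr (2/3))"
  proof (rule asymp_equivI'[OF Lim_transform_eventually[OF lim]])
    show "\<forall>\<^sub>F n in inf at_top (principal {n. odd n}). ?v n / osc_limit =
        Re (G n) / (6 powr (1/3) * Gamma (1/3) * (-1) ^ ((n + 1) div 2) / (4 * sqrt 3) * real n powr (2/3))"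
      unfolding eventually_inf_principal
    proof (intro always_eventually allI impI)
      fix n :: nat assume "n \<in> {n. odd n}"
      then have "odd n" by simp
      then obtain k where n: "n = 2 * k + 1" ..
      have W: "\<i> ^ (n + 1) * (G n - (-1) ^ n * cnj (G n)) = of_real ((-1) ^ Suc k * (2 * Re (G n)))"
      proof -
        have "n + 1 = 2 * Suc k" by (simp add: n)
        then have i_power: "\<i> ^ (n + 1) = (-1) ^ Suc k"
          by (simp only: power_mult power2_i)
        have sign: "(-1) ^ n = (-1::complex)"
          by (simp add: n)
        have sum: "G n + cnj (G n) = of_real (2 * Re (G n))"
          by (simp add: complex_eq_iff)
        show ?thesis
          unfolding i_power sign mult_minus1 diff_minus_eq_add sum by (cases "even k") simp_all
      qed
      have "?v n = (-1) ^ Suc k * (2 * Re (G n)) / real n powr (2/3)"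
        unfolding W Re_complex_of_real ..
      then show "?v n / osc_limit =
          Re (G n) / (6 powr (1/3) * Gamma (1/3) * (-1) ^ ((n + 1) div 2) / (4 * sqrt 3) * real n powr (2/3))"
        unfolding const by (cases "even k") (simp_all add: n mult.commute)
    qed
  qed
  fix n :: nat
  have "cnj (pochhammer a k) = pochhammer (cnj a) k" for a k
    by (induction k) (simp_all add: pochhammer_Suc)
  then show "exp (\<i> * of_nat n) * hyp3F1 n (- \<i> / (2 * of_nat n)) = cnj (G n)"
    by (simp add: G_def hyp3F1_def exp_cnj)
qed

end
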